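(* For positive integers $m,n$ let $G_{m\times n}$ denote the $m\times n$ grid graph. Then, as $m+n\to\infty$, $$\left(\tfrac12 - o(1)\right)(m+n) \le \operatorname{ept}(G_{m\times n}) \le (4+o(1))(m+n).$$ That is, for every $\varepsilon>0$ there is $N$ such that for all positive integers $m,n$ with $m+n\ge N$, $\left(\tfrac12-\varepsilon\right)(m+n)\le \operatorname{ept}(G_{m\times n})\le (4+\varepsilon)(m+n)$.
   Context: The grid graph $G_{m\times n}$ has vertex set $\{0,\dots,m-1\}\times\{0,\dots,n-1\}$, with two vertices adjacent iff they agree in one coordinate and differ by exactly $1$ in the other. Probabilistic zero forcing on a finite simple graph $G$: initially the vertices of a nonempty set $S$ are blue and all other vertices are white. At each discrete time step, independently for every ordered pair $(u,v)$ of adjacent vertices with $u$ blue and $v$ white (colors taken at the start of the step), $u$ forces $v$ with probability $C[u]/\deg u$, where $C[u]$ is the number of blue vertices in the closed neighborhood of $u$ (including $u$ itself). A white vertex forced by at least one blue vertex becomes blue at the end of the step; blue vertices stay blue forever. The propagation time of $S$ is the number of time steps until all vertices are blue, with value in $\mathbb{N}\cup\{\infty\}$; its expected value is $\operatorname{ept}(G,S)$. The expected propagation time of $G$ is $\operatorname{ept}(G)=\min_{v\in V(G)}\operatorname{ept}(G,\{v\})$. *)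

theory Defs
  imports "HOL-Probability.Probability" "Graph_Theory.Pair_Digraph"
begin

text \<open>
  A finite simple graph is a \<^locale>\<open>pair_graph\<close>: the arcs of \<^term>\<open>G\<close> are the ordered pairs of
  adjacent vertices, so that \<^const>\<open>out_degree\<close> is the usual degree.
\<close>

definition grid :: "nat \<Rightarrow> nat \<Rightarrow> (nat \<times> nat) pair_pre_digraph" where
  "grid m n =
    \<lparr>pverts = {0..<m} \<times> {0..<n},
     parcs = {((a, b), (c, d)). (a, b) \<in> {0..<m} \<times> {0..<n} \<and> (c, d) \<in> {0..<m} \<times> {0..<n} \<and>
       (a = c \<and> \<bar>int b - int d\<bar> = 1 \<or> b = d \<and> \<bar>int a - int c\<bar> = 1)}\<rparr>"

lemma pair_graph_grid: "pair_graph (grid m n)"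
proof -
  have sub: "parcs (grid m n) \<subseteq> pverts (grid m n) \<times> pverts (grid m n)"
    by (auto simp: grid_def)
  have fin: "finite (pverts (grid m n))"
    by (simp add: grid_def)
  show ?thesis
  proof
    show "finite (parcs (grid m n))"
      using sub fin by (meson finite_SigmaI finite_subset)
    show "symmetric (with_proj (grid m n))"
      unfolding symmetric_def by (rule symI) (auto simp: grid_def)
  qed (use sub fin in \<open>auto simp: grid_def\<close>)
qed

definition closed_nbhd :: "'a pair_pre_digraph \<Rightarrow> 'a \<Rightarrow> 'a set" where
  "closed_nbhd G u = insert u {w. (u, w) \<in> parcs G}"

definition force_prob :: "'a pair_pre_digraph \<Rightarrow> 'a set \<Rightarrow> 'a \<Rightarrow> real" where
  "force_prob G B u = card (closed_nbhd G u \<inter> B) / out_degree (with_proj G) u"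

text \<open>
  The randomness of the process is one uniform random number on the unit interval for every time
  step and every ordered pair of adjacent vertices, all independent. With blue set \<^term>\<open>B\<close> and
  numbers \<^term>\<open>U\<close>, the blue vertex \<^term>\<open>u\<close> forces its white neighbour \<^term>\<open>v\<close> iff
  \<^prop>\<open>U (u, v) < force_prob G B u\<close>; see lemma \<open>prob_force\<close> below for the probability of this
  event. The numbers of pairs that are not blue-white are ignored.
\<close>

definition step_space :: "'a pair_pre_digraph \<Rightarrow> ('a \<times> 'a \<Rightarrow> real) measure" where
  "step_space G = (\<Pi>\<^sub>M e\<in>parcs G. uniform_measure lborel {0..1})"

definition pzf_space :: "'a pair_pre_digraph \<Rightarrow> ('a \<times> 'a \<Rightarrow> real) stream measure" where
  "pzf_space G = stream_space (step_space G)"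

definition pzf_step ::
    "'a pair_pre_digraph \<Rightarrow> 'a set \<Rightarrow> ('a \<times> 'a \<Rightarrow> real) \<Rightarrow> 'a set" where
  "pzf_step G B U =
    B \<union> {v \<in> pverts G - B. \<exists>u\<in>B. (u, v) \<in> parcs G \<and> U (u, v) < force_prob G B u}"

primrec blue ::
    "'a pair_pre_digraph \<Rightarrow> 'a set \<Rightarrow> ('a \<times> 'a \<Rightarrow> real) stream \<Rightarrow> nat \<Rightarrow> 'a set" where
  "blue G S \<omega> 0 = S"
| "blue G S \<omega> (Suc t) = pzf_step G (blue G S \<omega> t) (\<omega> !! t)"

text \<open>The infimum of the empty set is \<^term>\<open>\<infinity> :: enat\<close>.\<close>

definition prop_time ::
    "'a pair_pre_digraph \<Rightarrow> 'a set \<Rightarrow> ('a \<times> 'a \<Rightarrow> real) stream \<Rightarrow> enat" where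
  "prop_time G S \<omega> = Inf (enat ` {t. blue G S \<omega> t = pverts G})"

definition ept_from :: "'a pair_pre_digraph \<Rightarrow> 'a set \<Rightarrow> ennreal" where
  "ept_from G S = (\<integral>\<^sup>+ \<omega>. ennreal_of_enat (prop_time G S \<omega>) \<partial>pzf_space G)"

definition ept :: "'a pair_pre_digraph \<Rightarrow> ennreal" where
  "ept G = Min ((\<lambda>v. ept_from G {v}) ` pverts G)"

lemma prob_space_uniform01: "prob_space (uniform_measure lborel {0..1::real})"
  by (rule prob_space_uniform_measure) auto

lemma prob_space_step_space: "prob_space (step_space G)"
  unfolding step_space_def by (intro prob_space_PiM prob_space_uniform01)

lemma prob_space_pzf_space: "prob_space (pzf_space G)"
  unfolding pzf_space_def
  using prob_space_step_space by (rule prob_space.prob_space_stream_space)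

lemma force_prob_le_1:
  assumes "pair_graph G" and uv: "(u, v) \<in> parcs G" "u \<in> B" "v \<notin> B"
  shows "0 \<le> force_prob G B u" "force_prob G B u \<le> 1"
proof -
  interpret pair_graph G by fact
  let ?N = "{w. (u, w) \<in> parcs G}"
  have "out_arcs (with_proj G) u = Pair u ` ?N"
    by (auto simp: out_arcs_def)
  then have deg: "out_degree (with_proj G) u = card ?N"
    by (simp add: out_degree_def card_image inj_on_def)
  have fin: "finite ?N"
    by (rule finite_subset[of _ "snd ` parcs G"]) (force, use pair_finite_arcs in simp)
  have "closed_nbhd G u \<inter> B \<subseteq> insert u (?N - {v})"
    using uv by (auto simp: closed_nbhd_def)
  then have "card (closed_nbhd G u \<inter> B) \<le> card (insert u (?N - {v}))"
    using fin by (intro card_mono) auto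
  also have "\<dots> \<le> Suc (card (?N - {v}))"
    by (rule card_insert_le_m1) (use fin in auto)
  also have "\<dots> = card ?N"
    using fin uv by (intro card_Suc_Diff1) auto
  finally have le: "real (card (closed_nbhd G u \<inter> B)) \<le> real (card ?N)"
    by simp
  show "force_prob G B u \<le> 1"
    unfolding force_prob_def deg by (rule divide_le_eq_1_pos[THEN iffD2, OF _ le]) (use fin uv in \<open>auto simp: card_gt_0_iff\<close>)
  show "0 \<le> force_prob G B u"
    by (simp add: force_prob_def)
qed

lemma prob_force:
  assumes "pair_graph G" "(u, v) \<in> parcs G" "u \<in> B" "v \<notin> B"
  shows "measure (step_space G) {U \<in> space (step_space G). U (u, v) < force_prob G B u} =
    force_prob G B u"
proof -
  let ?M = "uniform_measure lborel {0..1::real}" and ?p = "force_prob G B u"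
  interpret product_prob_space "\<lambda>_. ?M" "parcs G"
    by (intro product_prob_spaceI prob_space_uniform01)
  have "measure (step_space G) {U \<in> space (step_space G). U (u, v) < ?p} =
      measure (distr (step_space G) ?M (\<lambda>U. U (u, v))) {..<?p}"
    unfolding step_space_def using assms
    by (subst measure_distr) (auto intro!: arg_cong2[where f = measure])
  also have "\<dots> = measure ?M {..<?p}"
    unfolding step_space_def using assms by (subst PiM_component) auto
  also have "\<dots> = measure lborel ({0..1} \<inter> {..<?p})"
    by (simp add: measure_def) (metis divide_ennreal_def ennreal_inverse_1 mult.right_neutral)
  also have "{0..1} \<inter> {..<?p} = {0..<?p}"
    using force_prob_le_1[OF assms] by auto
  finally show ?thesis
    using force_prob_le_1[OF assms] by simp
qed

text \<open>The integrand of \<^const>\<open>ept_from\<close> is measurable.\<close>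

lemma measurable_blue:
  assumes "pair_graph G" "S \<subseteq> pverts G"
  shows "(\<lambda>\<omega>. blue G S \<omega> t) \<in> measurable (pzf_space G) (count_space (Pow (pverts G)))"
proof (induction t)
  case 0
  then show ?case using assms by simp
next
  case (Suc t)
  interpret pair_graph G by fact
  have step: "pzf_step G B \<in> measurable (step_space G) (count_space (Pow (pverts G)))"
    if B: "B \<in> Pow (pverts G)" for B
  proof (subst measurable_count_space_eq2)
    show "finite (Pow (pverts G))"
      using pair_finite_verts by simp
    show "pzf_step G B \<in> space (step_space G) \<rightarrow> Pow (pverts G) \<and>
      (\<forall>A\<in>Pow (pverts G). pzf_step G B -` {A} \<inter> space (step_space G) \<in> sets (step_space G))"
    proof (intro conjI ballI)
      show "pzf_step G B \<in> space (step_space G) \<rightarrow> Pow (pverts G)"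
        using B by (auto simp: pzf_step_def)
      fix A assume A: "A \<in> Pow (pverts G)"
      have fin: "finite B" "finite (pverts G)"
        using finite_subset[of B, OF _ pair_finite_verts] B pair_finite_verts by auto
      have arc: "{U \<in> space (step_space G). (u, v) \<in> parcs G \<and> U (u, v) < c}
          \<in> sets (step_space G)" for u v c
      proof (cases "(u, v) \<in> parcs G")
        case True
        have [measurable]: "(\<lambda>U. U (u, v)) \<in> borel_measurable (step_space G)"
        proof -
          have "(\<lambda>U. U (u, v)) \<in> measurable (step_space G) (uniform_measure lborel {0..1::real})"
            unfolding step_space_def by (rule measurable_component_singleton) (rule True)
          then show ?thesis
            by (simp cong: measurable_cong_sets)
        qed
        show ?thesis using True by simp
      qed simp
      let ?W = "\<lambda>v U. \<exists>u\<in>B. (u, v) \<in> parcs G \<and> U (u, v) < force_prob G B u"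
      have "pzf_step G B U = A \<longleftrightarrow> (\<forall>v\<in>pverts G. v \<in> A \<longleftrightarrow> v \<in> B \<or> ?W v U)" for U
      proof -
        have "pzf_step G B U \<subseteq> pverts G" "A \<subseteq> pverts G"
          using A B by (auto simp: pzf_step_def)
        then have "pzf_step G B U = A \<longleftrightarrow> (\<forall>v\<in>pverts G. v \<in> A \<longleftrightarrow> v \<in> pzf_step G B U)"
          by blast
        moreover have "v \<in> pzf_step G B U \<longleftrightarrow> v \<in> B \<or> ?W v U" if "v \<in> pverts G" for v
          using that unfolding pzf_step_def by blast
        ultimately show ?thesis
          by simp
      qed
      then have "pzf_step G B -` {A} \<inter> space (step_space G) =
          {U \<in> space (step_space G). \<forall>v\<in>pverts G. v \<in> A \<longleftrightarrow> v \<in> B \<or> ?W v U}"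
        by blast
      also have "\<dots> \<in> sets (step_space G)"
      proof -
        have [measurable]: "Measurable.pred (step_space G) (?W v)" for v
          using arc fin by (intro pred_intros_finite) (simp_all add: pred_def)
        have "Measurable.pred (step_space G) (\<lambda>U. v \<in> A \<longleftrightarrow> v \<in> B \<or> ?W v U)" for v
          by measurable
        then show ?thesis
          unfolding pred_def[symmetric] using fin by (intro pred_intros_finite)
      qed
      finally show "pzf_step G B -` {A} \<inter> space (step_space G) \<in> sets (step_space G)" .
    qed
  qed
  have "(\<lambda>\<omega>. pzf_step G (blue G S \<omega> t) (\<omega> !! t))
      \<in> measurable (pzf_space G) (count_space (Pow (pverts G)))"
  proof (rule measurable_compose_countable'[OF _ Suc.IH])
    show "countable (Pow (pverts G))"
      using pair_finite_verts by (intro countable_finite) simp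
    show "(\<lambda>\<omega>. pzf_step G B (\<omega> !! t))
        \<in> measurable (pzf_space G) (count_space (Pow (pverts G)))"
      if "B \<in> Pow (pverts G)" for B
      unfolding pzf_space_def by (rule measurable_compose[OF measurable_snth step[OF that]])
  qed
  then show ?case by simp
qed

lemma measurable_prop_time:
  assumes "pair_graph G" "S \<subseteq> pverts G"
  shows "(\<lambda>\<omega>. ennreal_of_enat (prop_time G S \<omega>)) \<in> borel_measurable (pzf_space G)"
proof -
  have "prop_time G S \<omega> = (INF t. if blue G S \<omega> t = pverts G then enat t else \<infinity>)" for \<omega>
    unfolding prop_time_def
  proof (rule antisym)
    show "Inf (enat ` {t. blue G S \<omega> t = pverts G}) \<le>
        (INF t. if blue G S \<omega> t = pverts G then enat t else \<infinity>)"
      by (rule INF_greatest) (auto intro: INF_lower)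
    show "(INF t. if blue G S \<omega> t = pverts G then enat t else \<infinity>) \<le>
        Inf (enat ` {t. blue G S \<omega> t = pverts G})"
    proof (rule INF_greatest)
      fix t assume "t \<in> {t. blue G S \<omega> t = pverts G}"
      then show "(INF t. if blue G S \<omega> t = pverts G then enat t else \<infinity>) \<le> enat t"
        by (intro INF_lower2[of t]) auto
    qed
  qed
  moreover have "{\<omega> \<in> space (pzf_space G). blue G S \<omega> t = pverts G} \<in> sets (pzf_space G)" for t
    using measurable_sets[OF measurable_blue[OF assms, of t], of "{pverts G}"]
    by (simp add: vimage_def Int_def conj_commute)
  then have "(\<lambda>\<omega>. INF t. if blue G S \<omega> t = pverts G then enat t else \<infinity>)
      \<in> measurable (pzf_space G) (count_space UNIV)"
    by (intro measurable_INF measurable_If) (auto simp: pred_def)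
  ultimately have "prop_time G S \<in> measurable (pzf_space G) (count_space UNIV)"
    by presburger
  then show ?thesis
    by (rule measurable_compose) simp
qed

end

theory Submission
  imports Defs
begin

text \<open>
  Lower bound: the blue set spreads by distance at most one per step, and every vertex has a corner
  at distance at least \<open>(m + n - 2) / 2\<close>.

  Upper bound: start in a corner. A blue vertex with a white neighbour has a blue neighbour unless
  it is the start, so it forces with probability at least \<open>1 / 2\<close> (\<open>2 / 4\<close>, or \<open>1 / 2\<close> in the corner).
  Hence the distance from the blue set to a white vertex \<open>w\<close> drops with probability at least
  \<open>1 / 2\<close> in each step, and \<open>3\<close> to the power of this distance, summed over all white \<open>w\<close>, is
  a potential that shrinks by the factor \<open>2 / 3\<close> in expectation. For \<open>L = m + n\<close> it is at
  most \<open>L\<^sup>2 * 3 ^ L\<close> initially, and at least \<open>1\<close> until all vertices are blue. So the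
  expected number of steps after time \<open>4 * L\<close> is at most \<open>3 * L\<^sup>2 * 3 ^ L * (2 / 3) ^ (4 * L)\<close>,
  which tends to \<open>0\<close> because \<open>3 * (2 / 3) ^ 4 < 1\<close>.
\<close>

section \<open>The process on a graph\<close>

lemma blue_Suc_SCons: "blue G S (U ## \<omega>) (Suc t) = blue G (pzf_step G S U) \<omega> t"
  by (induction t) simp_all

lemma le_prop_time:
  assumes "\<And>t. blue G S \<omega> t = pverts G \<Longrightarrow> k \<le> t"
  shows "enat k \<le> prop_time G S \<omega>"
  unfolding prop_time_def using assms by (auto intro!: INF_greatest)

lemma blue_neq_before_prop_time:
  assumes "enat t < prop_time G S \<omega>"
  shows "blue G S \<omega> t \<noteq> pverts G"
  using assms unfolding prop_time_def by (metis (mono_tags) INF_lower leD mem_Collect_eq)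

text \<open>Pathwise, before any expectation: each step from \<open>T\<close> on at which a white
  vertex remains contributes at least 1 to the sum. Infinite propagation time is covered
  too.\<close>

lemma prop_time_le_suminf:
  fixes \<Phi> :: "nat \<Rightarrow> ennreal"
  assumes "\<And>t. blue G S \<omega> t \<noteq> pverts G \<Longrightarrow> 1 \<le> \<Phi> t"
  shows "ennreal_of_enat (prop_time G S \<omega>) \<le> of_nat T + (\<Sum>k. \<Phi> (T + k))"
proof -
  \<comment> \<open>Stated for every finite \<open>k\<close> below the propagation time, so that an
    infinite one follows by taking the supremum over \<open>k\<close>.\<close>
  have *: "of_nat k \<le> of_nat T + (\<Sum>k. \<Phi> (T + k))" if k: "enat k \<le> prop_time G S \<omega>" for k
  proof -
    have "of_nat (k - T) = (\<Sum>i<k - T. 1 :: ennreal)"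
      by simp
    also have "\<dots> \<le> (\<Sum>i<k - T. \<Phi> (T + i))"
    proof (intro sum_mono assms blue_neq_before_prop_time)
      fix i assume "i \<in> {..<k - T}"
      then have "enat (T + i) < enat k" by simp
      with k show "enat (T + i) < prop_time G S \<omega>" by (rule less_le_trans[rotated])
    qed
    also have "\<dots> \<le> (\<Sum>k. \<Phi> (T + k))"
      by (intro sum_le_suminf) auto
    finally have "of_nat (T + (k - T)) \<le> of_nat T + (\<Sum>k. \<Phi> (T + k))"
      by (simp add: add_left_mono)
    moreover have "of_nat k \<le> (of_nat (T + (k - T)) :: ennreal)"
      by (rule of_nat_mono) simp
    ultimately show ?thesis by (rule order_trans[rotated])
  qed
  show ?thesis
  proof (cases "prop_time G S \<omega>")
    case (enat k)
    then show ?thesis using *[of k] by simp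
  next
    case infinity
    have "(SUP k. of_nat k :: ennreal) \<le> of_nat T + (\<Sum>k. \<Phi> (T + k))"
      by (intro SUP_least *) (simp add: infinity)
    then show ?thesis
      by (simp add: infinity ennreal_SUP_of_nat_eq_top)
  qed
qed

text \<open>A single step is the process at time 1, so \<open>measurable_blue\<close> applies once
  \<open>U\<close> is extended to a stream; the tail \<open>sconst U\<close> is arbitrary, as only
  the first entry is read.\<close>

lemma measurable_pzf_step:
  assumes "pair_graph G" "B \<subseteq> pverts G"
  shows "pzf_step G B \<in> measurable (step_space G) (count_space (Pow (pverts G)))"
proof -
  have sconst: "(\<lambda>U. (U ## sconst U) !! k) \<in> measurable (step_space G) (step_space G)" for k
    by (cases k) simp_all
  have "(\<lambda>\<omega>. blue G B \<omega> (Suc 0)) \<circ> (\<lambda>U. U ## sconst U)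
      \<in> measurable (step_space G) (count_space (Pow (pverts G)))"
    unfolding comp_def
    by (rule measurable_compose[OF _ measurable_blue[OF assms]])
      (unfold pzf_space_def, rule measurable_stream_space2, rule sconst)
  then show ?thesis by (simp add: comp_def)
qed

section \<open>Lower bound\<close>

text \<open>By induction, a vertex blue at time \<open>t\<close> has \<open>d\<close> at most
  \<open>t\<close>. This holds for every outcome, so no probability enters the lower bound before
  the final integration.\<close>

lemma distance_le_prop_time:
  fixes d :: "'a \<Rightarrow> nat"
  assumes "\<And>u v. (u, v) \<in> parcs G \<Longrightarrow> d v \<le> Suc (d u)" and "d r = 0" and "w \<in> pverts G"
  shows "enat (d w) \<le> prop_time G {r} \<omega>"
proof (rule le_prop_time)
  fix t assume "blue G {r} \<omega> t = pverts G"
  moreover have "d v \<le> t" if "v \<in> blue G {r} \<omega> t" for v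
    using that
  proof (induction t arbitrary: v)
    case (Suc t)
    from Suc.prems consider "v \<in> blue G {r} \<omega> t"
      | u where "u \<in> blue G {r} \<omega> t" "(u, v) \<in> parcs G"
      by (auto simp: pzf_step_def)
    then show ?case
    proof cases
      case 1
      then show ?thesis using Suc.IH[of v] by simp
    next
      case (2 u)
      then show ?thesis using Suc.IH[of u] assms(1)[of u v] by simp
    qed
  qed (use assms in simp)
  ultimately show "d w \<le> t"
    using assms by blast
qed

lemma const_le_ept_from:
  assumes "\<And>\<omega>. enat k \<le> prop_time G S \<omega>"
  shows "of_nat k \<le> ept_from G S"
proof -
  interpret prob_space "pzf_space G" by (rule prob_space_pzf_space)
  have "of_nat k = (\<integral>\<^sup>+ \<omega>. of_nat k \<partial>pzf_space G)"
    by (simp add: emeasure_space_1)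
  also have "\<dots> \<le> ept_from G S"
    unfolding ept_from_def
    using assms by (intro nn_integral_mono) (metis ennreal_of_enat_enat ennreal_of_enat_le_iff)
  finally show ?thesis .
qed

section \<open>Upper bound\<close>

text \<open>Isolates what the upper bound needs from the grid. \<open>d\<close> need not be a
  metric: it only has to be decreasable along an arc, so that a blue vertex nearest to
  \<open>w\<close> has a neighbour closer to \<open>w\<close>.\<close>

locale descending_distance = pair_graph G for G :: "'a pair_pre_digraph" +
  fixes d :: "'a \<Rightarrow> 'a \<Rightarrow> nat" and r :: 'a
  assumes root: "r \<in> pverts G"
    and descent: "\<lbrakk>u \<in> pverts G; w \<in> pverts G; u \<noteq> w\<rbrakk> \<Longrightarrow> \<exists>v. (u, v) \<in> parcs G \<and> d v w < d u w"
    and degree_le: "u \<in> pverts G \<Longrightarrow> card {v. (u, v) \<in> parcs G} \<le> 4"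
    and degree_root_le: "card {v. (r, v) \<in> parcs G} \<le> 2"
begin

text \<open>The invariant behind forcing probabilities of at least 1/2; only the root may lack a
  blue neighbour.\<close>

definition supported :: "'a set \<Rightarrow> bool" where
  "supported B \<longleftrightarrow> r \<in> B \<and> B \<subseteq> pverts G \<and> (\<forall>v\<in>B. v \<noteq> r \<longrightarrow> (\<exists>u\<in>B. (v, u) \<in> parcs G))"

text \<open>Base 3 is the best choice for time \<open>4 * L\<close>: a base b > 0 shrinks by (1 +
  1/b) / 2 per step, and b * ((1 + 1/b) / 2)^4 is least at b = 3.\<close>

definition white_weight :: "'a set \<Rightarrow> 'a \<Rightarrow> ennreal" where
  "white_weight B w = (if w \<in> B then 0 else 3 ^ Min ((\<lambda>u. d u w) ` B))"

definition potential :: "'a set \<Rightarrow> ennreal" where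
  "potential B = (\<Sum>w\<in>pverts G. white_weight B w)"

lemma supported_root: "supported {r}"
  using root by (simp add: supported_def)

lemma supported_finite: "supported B \<Longrightarrow> finite B"
  unfolding supported_def using finite_subset pair_finite_verts by blast

text \<open>A newly blue vertex is adjacent to the vertex that forced it, by symmetry of the
  arcs.\<close>

lemma supported_step: "supported B \<Longrightarrow> supported (pzf_step G B U)"
  unfolding supported_def pzf_step_def by (auto intro: arcs_symmetric)

lemma force_prob_ge_half:
  assumes B: "supported B" and uv: "(u, v) \<in> parcs G" "u \<in> B"
  shows "1 / 2 \<le> force_prob G B u"
proof -
  let ?N = "{w. (u, w) \<in> parcs G}"
  have "out_arcs (with_proj G) u = Pair u ` ?N"
    by (auto simp: out_arcs_def)
  then have deg: "out_degree (with_proj G) u = card ?N"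
    by (simp add: out_degree_def card_image inj_on_def)
  have "finite ?N"
    by (rule finite_subset[of _ "snd ` parcs G"]) (force, use pair_finite_arcs in simp)
  then have pos: "0 < card ?N"
    using uv by (auto simp: card_gt_0_iff)
  have fin: "finite (closed_nbhd G u \<inter> B)"
    using supported_finite[OF B] by simp
  have "card ?N \<le> 2 * card (closed_nbhd G u \<inter> B)"
  proof (cases "u = r")
    case True
    have "card {u} \<le> card (closed_nbhd G u \<inter> B)"
      using uv by (intro card_mono fin) (auto simp: closed_nbhd_def)
    then show ?thesis
      using degree_root_le True by simp
  next
    case False
    then obtain x where x: "x \<in> B" "(u, x) \<in> parcs G"
      using B uv unfolding supported_def by blast
    then have "x \<noteq> u"
      using no_loops[OF x(2)] by simp
    then have "2 = card {u, x}" by simp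
    also have "\<dots> \<le> card (closed_nbhd G u \<inter> B)"
      using uv x by (intro card_mono fin) (auto simp: closed_nbhd_def)
    finally show ?thesis
      using degree_le[of u] B uv unfolding supported_def by fastforce
  qed
  then show ?thesis
    unfolding force_prob_def deg using pos by (simp add: field_simps)
qed

lemma emeasure_not_force:
  assumes B: "supported B" and uv: "(u, v) \<in> parcs G" "u \<in> B" "v \<notin> B"
  shows "emeasure (step_space G) {U \<in> space (step_space G). \<not> U (u, v) < force_prob G B u} \<le> ennreal (1 / 2)"
    and "{U \<in> space (step_space G). \<not> U (u, v) < force_prob G B u} \<in> sets (step_space G)"
proof -
  interpret P: prob_space "step_space G" by (rule prob_space_step_space)
  let ?A = "{U \<in> space (step_space G). U (u, v) < force_prob G B u}"
  have "(\<lambda>U. U (u, v)) \<in> measurable (step_space G) (uniform_measure lborel {0..1::real})"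
    unfolding step_space_def by (rule measurable_component_singleton) (rule uv)
  then have [measurable]: "(\<lambda>U. U (u, v)) \<in> borel_measurable (step_space G)"
    by (simp cong: measurable_cong_sets)
  have A: "?A \<in> sets (step_space G)" by simp
  show "{U \<in> space (step_space G). \<not> U (u, v) < force_prob G B u} \<in> sets (step_space G)" by simp
  have "{U \<in> space (step_space G). \<not> U (u, v) < force_prob G B u} = space (step_space G) - ?A"
    by auto
  then have "measure (step_space G) {U \<in> space (step_space G). \<not> U (u, v) < force_prob G B u}
      = 1 - force_prob G B u"
    using P.prob_compl[OF A] prob_force[OF pair_graph_axioms uv] by simp
  also have "\<dots> \<le> 1 / 2"
    using force_prob_ge_half[OF B uv(1,2)] by simp
  finally show "emeasure (step_space G) {U \<in> space (step_space G). \<not> U (u, v) < force_prob G B u} \<le> ennreal (1 / 2)"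
    unfolding P.emeasure_eq_measure by (rule ennreal_leI)
qed

section \<open>Contraction of the potential in expectation\<close>

lemma white_weight_le: "\<lbrakk>finite B; u \<in> B; d u w \<le> k\<rbrakk> \<Longrightarrow> white_weight B w \<le> 3 ^ k"
proof -
  assume *: "finite B" "u \<in> B" "d u w \<le> k"
  then have "Min ((\<lambda>u. d u w) ` B) \<le> k"
    by (meson Min_le finite_imageI imageI order_trans)
  then show ?thesis
    by (simp add: white_weight_def power_increasing)
qed

text \<open>It suffices to watch one arc, from a nearest blue vertex \<open>u\<close> to a neighbour
  \<open>v\<close> closer to \<open>w\<close>, which is white by minimality. If \<open>u\<close>
  forces \<open>v\<close>, the weight falls to a third or less; otherwise it does not grow, since
  blue vertices stay blue. The mean factor is at most (1 + 1/3) / 2 = 2/3.\<close>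

lemma white_weight_step:
  assumes B: "supported B" and w: "w \<in> pverts G"
  shows "(\<integral>\<^sup>+ U. white_weight (pzf_step G B U) w \<partial>step_space G) \<le> ennreal (2 / 3) * white_weight B w"
proof (cases "w \<in> B")
  case True
  then have "white_weight (pzf_step G B U) w = 0" for U
    by (auto simp: white_weight_def pzf_step_def)
  then show ?thesis by simp
next
  case False
  interpret P: prob_space "step_space G" by (rule prob_space_step_space)
  define k where "k = Min ((\<lambda>u. d u w) ` B)"
  have fin: "finite B" and ne: "B \<noteq> {}" and sub: "B \<subseteq> pverts G"
    using supported_finite[OF B] B by (auto simp: supported_def)
  have "k \<in> (\<lambda>u. d u w) ` B"
    unfolding k_def using fin ne by (intro Min_in) auto
  then obtain u where u: "u \<in> B" "d u w = k" by auto
  with False sub w obtain v where v: "(u, v) \<in> parcs G" "d v w < k"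
    using descent[of u w] by blast
  have "v \<notin> B"
  proof
    assume "v \<in> B"
    then have "k \<le> d v w"
      unfolding k_def using fin by (intro Min_le) auto
    with v(2) show False by simp
  qed
  let ?N = "{U \<in> space (step_space G). \<not> U (u, v) < force_prob G B u}"
  note N = emeasure_not_force[OF B v(1) u(1) \<open>v \<notin> B\<close>]
  have weights: "2 * ennreal (1 / 2) = 1" "3 * ennreal (2 / 3) = 2"
    by (subst numeral_mult_ennreal; simp)+
  obtain j where j: "k = Suc j"
    using v(2) by (cases k) auto
  \<comment> \<open>With \<open>k = Suc j\<close>, the majorant is \<open>3 ^ j\<close> if the arc
    forces and \<open>3 ^ k\<close>, written as \<open>3 ^ j + 2 * 3 ^ j\<close>, on the failure
    event \<open>?N\<close>.\<close>
  have "(\<integral>\<^sup>+ U. white_weight (pzf_step G B U) w \<partial>step_space G)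
      \<le> (\<integral>\<^sup>+ U. 3 ^ j + (2 * 3 ^ j) * indicator ?N U \<partial>step_space G)"
  proof (rule nn_integral_mono)
    fix U assume U: "U \<in> space (step_space G)"
    have fin': "finite (pzf_step G B U)"
      using supported_finite[OF supported_step[OF B]] .
    show "white_weight (pzf_step G B U) w \<le> 3 ^ j + (2 * 3 ^ j) * indicator ?N U"
    proof (cases "U \<in> ?N")
      case True
      have "u \<in> pzf_step G B U"
        using u by (simp add: pzf_step_def)
      then have "white_weight (pzf_step G B U) w \<le> 3 ^ k"
        using white_weight_le[OF fin'] u by simp
      also have "(3::ennreal) ^ k = 3 ^ j + 2 * 3 ^ j"
        unfolding j by (metis (no_types) distrib_right mult.left_neutral one_plus_numeral power_Suc semiring_norm(3))
      finally show ?thesis using True by simp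
    next
      case False
      then have "v \<in> pzf_step G B U"
        using u v U in_arcsD2[OF v(1)] by (auto simp: pzf_step_def)
      then show ?thesis
        using white_weight_le[OF fin', of v w j] v False j by simp
    qed
  qed
  also have "\<dots> = 3 ^ j + (2 * 3 ^ j) * emeasure (step_space G) ?N"
    using N(2) by (simp add: nn_integral_add nn_integral_cmult P.emeasure_space_1)
  also have "\<dots> \<le> 3 ^ j + (2 * 3 ^ j) * ennreal (1 / 2)"
    by (intro add_left_mono mult_left_mono N) simp
  also have "\<dots> = 3 ^ j * (1 + 2 * ennreal (1 / 2))"
    by (simp only: distrib_left mult_1_left mult_1_right mult_ac)
  also have "1 + 2 * ennreal (1 / 2) = 3 * ennreal (2 / 3)"
    by (simp only: weights one_add_one)
  also have "3 ^ j * (3 * ennreal (2 / 3)) = ennreal (2 / 3) * white_weight B w"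
    using False by (simp add: white_weight_def k_def[symmetric] j mult_ac)
  finally show ?thesis .
qed

lemma measurable_potential [measurable]:
  "potential \<in> measurable (count_space (Pow (pverts G))) borel"
  "(\<lambda>B. white_weight B w) \<in> measurable (count_space (Pow (pverts G))) borel"
  by simp_all

lemma potential_step:
  assumes B: "supported B"
  shows "(\<integral>\<^sup>+ U. potential (pzf_step G B U) \<partial>step_space G) \<le> ennreal (2 / 3) * potential B"
proof -
  have [measurable]: "pzf_step G B \<in> measurable (step_space G) (count_space (Pow (pverts G)))"
    using B by (intro measurable_pzf_step pair_graph_axioms) (simp add: supported_def)
  have "(\<integral>\<^sup>+ U. potential (pzf_step G B U) \<partial>step_space G)
      = (\<Sum>w\<in>pverts G. \<integral>\<^sup>+ U. white_weight (pzf_step G B U) w \<partial>step_space G)"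
    unfolding potential_def by (subst nn_integral_sum) auto
  also have "\<dots> \<le> (\<Sum>w\<in>pverts G. ennreal (2 / 3) * white_weight B w)"
    by (intro sum_mono white_weight_step B)
  finally show ?thesis
    by (simp add: potential_def sum_distrib_left)
qed

lemma measurable_potential_blue:
  "supported B \<Longrightarrow> (\<lambda>\<omega>. potential (blue G B \<omega> t)) \<in> borel_measurable (pzf_space G)"
  by (rule measurable_compose[OF measurable_blue measurable_potential(1)])
    (auto simp: supported_def pair_graph_axioms)

text \<open>The induction splits off the first step: the rest of the stream is an independent fresh
  copy driving the process from the random set \<open>pzf_step G B U\<close>. Hence \<open>B\<close>
  is arbitrary in the induction.\<close>

lemma potential_blue:
  assumes "supported B"
  shows "(\<integral>\<^sup>+ \<omega>. potential (blue G B \<omega> t) \<partial>pzf_space G) \<le> ennreal ((2 / 3) ^ t) * potential B"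
  using assms
proof (induction t arbitrary: B)
  case 0
  interpret prob_space "pzf_space G" by (rule prob_space_pzf_space)
  show ?case by (simp add: emeasure_space_1)
next
  case (Suc t)
  interpret P: prob_space "step_space G" by (rule prob_space_step_space)
  have "(\<integral>\<^sup>+ \<omega>. potential (blue G B \<omega> (Suc t)) \<partial>pzf_space G)
      = (\<integral>\<^sup>+ U. \<integral>\<^sup>+ \<omega>. potential (blue G B (U ## \<omega>) (Suc t)) \<partial>pzf_space G \<partial>step_space G)"
    unfolding pzf_space_def
    by (rule P.nn_integral_stream_space)
      (use measurable_potential_blue[OF Suc.prems, of "Suc t"] in \<open>simp add: pzf_space_def\<close>)
  also have "\<dots> \<le> (\<integral>\<^sup>+ U. ennreal ((2 / 3) ^ t) * potential (pzf_step G B U) \<partial>step_space G)"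
    unfolding blue_Suc_SCons by (intro nn_integral_mono Suc.IH supported_step Suc.prems)
  also have "\<dots> = ennreal ((2 / 3) ^ t) * (\<integral>\<^sup>+ U. potential (pzf_step G B U) \<partial>step_space G)"
    using Suc.prems
    by (intro nn_integral_cmult measurable_compose[OF measurable_pzf_step measurable_potential(1)])
      (auto simp: supported_def pair_graph_axioms)
  also have "\<dots> \<le> ennreal ((2 / 3) ^ t) * (ennreal (2 / 3) * potential B)"
    by (intro mult_left_mono potential_step Suc.prems) simp
  also have "\<dots> = ennreal ((2 / 3) ^ t * (2 / 3)) * potential B"
    by (subst ennreal_mult) (simp_all add: mult.assoc)
  also have "(2 / 3) ^ t * (2 / 3) = (2 / 3 :: real) ^ Suc t"
    by (rule power_Suc2[symmetric])
  finally show ?case .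
qed

section \<open>From the decaying potential to the expected time\<close>

lemma one_le_potential:
  assumes "supported B" "B \<noteq> pverts G"
  shows "1 \<le> potential B"
proof -
  obtain w where w: "w \<in> pverts G" "w \<notin> B"
    using assms by (auto simp: supported_def)
  have "1 \<le> white_weight B w"
    using w by (simp add: white_weight_def)
  also have "\<dots> \<le> potential B"
    unfolding potential_def using w by (intro member_le_sum) auto
  finally show ?thesis .
qed

lemma supported_blue: "supported B \<Longrightarrow> supported (blue G B \<omega> t)"
  by (induction t) (simp_all add: supported_step)

lemma potential_root_le:
  assumes "\<And>w. w \<in> pverts G \<Longrightarrow> d r w \<le> L"
  shows "potential {r} \<le> ennreal (real (card (pverts G)) * 3 ^ L)"
proof -
  have "potential {r} \<le> (\<Sum>w\<in>pverts G. 3 ^ L)"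
    unfolding potential_def using assms by (intro sum_mono white_weight_le[of _ r]) auto
  also have "\<dots> = ennreal (real (card (pverts G)) * 3 ^ L)"
    by (simp add: ennreal_mult ennreal_of_nat_eq_real_of_nat flip: ennreal_numeral ennreal_power)
  finally show ?thesis .
qed

text \<open>Integrating \<open>prop_time_le_suminf\<close> with the potential as
  \<open>\<Phi>\<close> leaves a geometric tail; the factor 3 is 1 / (1 - 2/3). The cut-off
  \<open>T\<close> stays free, to be balanced against \<open>L\<close> later.\<close>

lemma ept_from_root_le:
  assumes "\<And>w. w \<in> pverts G \<Longrightarrow> d r w \<le> L"
  shows "ept_from G {r} \<le> ennreal (real T + 3 * (2 / 3) ^ T * (real (card (pverts G)) * 3 ^ L))"
proof -
  interpret P: prob_space "pzf_space G" by (rule prob_space_pzf_space)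
  let ?c = "real (card (pverts G)) * 3 ^ L"
  note [measurable] = measurable_potential_blue[OF supported_root]
  have "ept_from G {r} \<le>
      (\<integral>\<^sup>+ \<omega>. of_nat T + (\<Sum>k. potential (blue G {r} \<omega> (T + k))) \<partial>pzf_space G)"
    unfolding ept_from_def
    by (intro nn_integral_mono prop_time_le_suminf one_le_potential supported_blue supported_root)
  also have "\<dots> = of_nat T + (\<Sum>k. \<integral>\<^sup>+ \<omega>. potential (blue G {r} \<omega> (T + k)) \<partial>pzf_space G)"
    by (simp add: nn_integral_add nn_integral_suminf P.emeasure_space_1)
  also have "\<dots> \<le> of_nat T + (\<Sum>k. ennreal ((2 / 3) ^ (T + k) * ?c))"
  proof (intro add_left_mono suminf_le)
    fix k
    have "(\<integral>\<^sup>+ \<omega>. potential (blue G {r} \<omega> (T + k)) \<partial>pzf_space G)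
        \<le> ennreal ((2 / 3) ^ (T + k)) * potential {r}"
      by (rule potential_blue[OF supported_root])
    also have "\<dots> \<le> ennreal ((2 / 3) ^ (T + k)) * ennreal ?c"
      by (intro mult_left_mono potential_root_le assms) auto
    finally show "(\<integral>\<^sup>+ \<omega>. potential (blue G {r} \<omega> (T + k)) \<partial>pzf_space G)
        \<le> ennreal ((2 / 3) ^ (T + k) * ?c)"
      by (simp add: ennreal_mult)
  qed auto
  also have "(\<Sum>k. ennreal ((2 / 3) ^ (T + k) * ?c)) = ennreal (3 * (2 / 3) ^ T * ?c)"
  proof (rule suminf_ennreal_eq)
    have "(\<lambda>k. ((2 / 3) ^ T * ?c) * (2 / 3) ^ k) sums (((2 / 3) ^ T * ?c) * (1 / (1 - 2 / 3)))"
      by (intro sums_mult geometric_sums) simp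
    then show "(\<lambda>k. (2 / 3) ^ (T + k) * ?c) sums (3 * (2 / 3) ^ T * ?c)"
      by (simp add: power_add mult_ac)
  qed simp
  finally show ?thesis
    by (simp add: ennreal_of_nat_eq_real_of_nat ennreal_plus)
qed

end

section \<open>The grid\<close>

definition grid_dist :: "nat \<times> nat \<Rightarrow> nat \<times> nat \<Rightarrow> nat" where
  "grid_dist u v = nat (\<bar>int (fst u) - int (fst v)\<bar> + \<bar>int (snd u) - int (snd v)\<bar>)"

lemma grid_dist_arc: "(u, v) \<in> parcs (grid m n) \<Longrightarrow> grid_dist r v \<le> Suc (grid_dist r u)"
  by (auto simp: grid_def grid_dist_def)

lemma grid_far_corner:
  assumes "r \<in> pverts (grid m n)"
  shows "\<exists>w\<in>pverts (grid m n). m + n \<le> 2 * grid_dist r w + 2"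
proof -
  \<comment> \<open>In each coordinate the end farther from \<open>r\<close>, at distance at least
    \<open>(m - 1) / 2\<close> and \<open>(n - 1) / 2\<close> respectively.\<close>
  define w where "w = (if 2 * fst r < m then m - 1 else 0, if 2 * snd r < n then n - 1 else 0)"
  show ?thesis
    using assms by (intro bexI[of _ w]) (auto simp: w_def grid_def grid_dist_def split: if_splits)
qed

text \<open>A unit step towards \<open>w\<close> in a coordinate where \<open>u\<close> and
  \<open>w\<close> differ does not overshoot, hence stays in the grid.\<close>

lemma grid_descent:
  assumes "u \<in> pverts (grid m n)" "w \<in> pverts (grid m n)" "u \<noteq> w"
  shows "\<exists>v. (u, v) \<in> parcs (grid m n) \<and> grid_dist v w < grid_dist u w"
proof -
  obtain a b c e where [simp]: "u = (a, b)" "w = (c, e)" by (cases u, cases w)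
  consider "a < c" | "c < a" | "b < e" | "e < b"
    using assms(3) by fastforce
  then show ?thesis
  proof cases
    case 1
    then show ?thesis using assms by (intro exI[of _ "(Suc a, b)"]) (auto simp: grid_def grid_dist_def)
  next
    case 2
    then show ?thesis using assms by (intro exI[of _ "(a - 1, b)"]) (auto simp: grid_def grid_dist_def)
  next
    case 3
    then show ?thesis using assms by (intro exI[of _ "(a, Suc b)"]) (auto simp: grid_def grid_dist_def)
  next
    case 4
    then show ?thesis using assms by (intro exI[of _ "(a, b - 1)"]) (auto simp: grid_def grid_dist_def)
  qed
qed

lemma grid_degree_le: "card {v. (u, v) \<in> parcs (grid m n)} \<le> 4"
proof -
  obtain a b where u: "u = (a, b)" by (cases u)
  \<comment> \<open>Truncated subtraction turns \<open>(a - 1, b)\<close> into \<open>u\<close> when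
    \<open>a = 0\<close>, and likewise for \<open>b\<close>; the list only has to cover the
    neighbours.\<close>
  let ?xs = "[(Suc a, b), (a - 1, b), (a, Suc b), (a, b - 1)]"
  have "card {v. (u, v) \<in> parcs (grid m n)} \<le> card (set ?xs)"
    by (intro card_mono) (auto simp: u grid_def)
  also have "\<dots> \<le> length ?xs"
    by (rule card_length)
  finally show ?thesis by simp
qed

lemma grid_degree_origin_le: "card {v. ((0, 0), v) \<in> parcs (grid m n)} \<le> 2"
proof -
  have "card {v. ((0, 0), v) \<in> parcs (grid m n)} \<le> card (set [(1, 0), (0, 1 :: nat)] :: (nat \<times> nat) set)"
    by (intro card_mono) (auto simp: grid_def)
  then show ?thesis by simp
qed

lemma descending_distance_grid:
  assumes "m > 0" "n > 0"
  shows "descending_distance (grid m n) grid_dist (0, 0)"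
proof -
  interpret pair_graph "grid m n" by (rule pair_graph_grid)
  show ?thesis
    using assms
    by unfold_locales (rule grid_descent grid_degree_le grid_degree_origin_le | assumption | simp add: grid_def)+
qed

lemma finite_verts_grid: "finite (pverts (grid m n))"
  by (simp add: grid_def)

lemma ept_grid_lower:
  assumes "m > 0" "n > 0"
  shows "ennreal (real (m + n) / 2 - 1) \<le> ept (grid m n)"
proof -
  have "ennreal (real (m + n) / 2 - 1) \<le> ept_from (grid m n) {r}" if r: "r \<in> pverts (grid m n)" for r
  proof -
    obtain w where w: "w \<in> pverts (grid m n)" "m + n \<le> 2 * grid_dist r w + 2"
      using grid_far_corner[OF r] by auto
    have "ennreal (real (m + n) / 2 - 1) \<le> of_nat (grid_dist r w)"
      using of_nat_mono[OF w(2), where 'a = real]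
      unfolding ennreal_of_nat_eq_real_of_nat by (intro ennreal_leI) (simp add: field_simps)
    also have "\<dots> \<le> ept_from (grid m n) {r}"
      by (intro const_le_ept_from distance_le_prop_time grid_dist_arc w) (auto simp: grid_dist_def)
    finally show ?thesis .
  qed
  moreover have "pverts (grid m n) \<noteq> {}"
    using assms by (simp add: grid_def)
  ultimately show ?thesis
    unfolding ept_def by (subst Min_ge_iff) (auto simp: finite_verts_grid)
qed

lemma ept_grid_upper:
  assumes "m > 0" "n > 0"
  defines "L \<equiv> m + n"
  shows "ept (grid m n) \<le> ennreal (4 * real L + 3 * (real L)\<^sup>2 * (16 / 27) ^ L)"
proof -
  interpret descending_distance "grid m n" grid_dist "(0, 0)"
    using assms by (intro descending_distance_grid)
  have "ept (grid m n) \<le> ept_from (grid m n) {(0, 0)}"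
    unfolding ept_def using root by (intro Min_le) (auto simp: finite_verts_grid)
  \<comment> \<open>Cut-off \<open>T = 4 * L\<close>: then \<open>3 ^ L\<close> times
    \<open>(2 / 3) ^ T\<close> is \<open>(16 / 27) ^ L\<close>, which outweighs the quadratic number
    of vertices.\<close>
  also have "\<dots> \<le> ennreal (real (4 * L) + 3 * (2 / 3) ^ (4 * L) * (real (card (pverts (grid m n))) * 3 ^ L))"
    by (rule ept_from_root_le) (auto simp: grid_def grid_dist_def L_def)
  also have "\<dots> \<le> ennreal (4 * real L + 3 * (real L)\<^sup>2 * (16 / 27) ^ L)"
  proof (rule ennreal_leI)
    have "m * n \<le> L\<^sup>2"
      unfolding L_def power2_eq_square by (intro mult_mono) auto
    then have card: "real (card (pverts (grid m n))) \<le> (real L)\<^sup>2"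
      by (simp add: grid_def flip: of_nat_mult of_nat_power)
    have "3 * (2 / 3) ^ (4 * L) * (real (card (pverts (grid m n))) * 3 ^ L)
        \<le> 3 * (2 / 3) ^ (4 * L) * ((real L)\<^sup>2 * 3 ^ L)"
      by (intro mult_left_mono mult_right_mono card) auto
    also have "\<dots> = 3 * (real L)\<^sup>2 * (((2 / 3) ^ 4) ^ L * 3 ^ L)"
      by (simp add: power_mult)
    also have "((2 / 3) ^ 4) ^ L * 3 ^ L = (16 / 27 :: real) ^ L"
      unfolding power_mult_distrib[symmetric] by (simp add: eval_nat_numeral)
    finally show "real (4 * L) + 3 * (2 / 3) ^ (4 * L) * (real (card (pverts (grid m n))) * 3 ^ L)
        \<le> 4 * real L + 3 * (real L)\<^sup>2 * (16 / 27) ^ L"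
      by simp
  qed
  finally show ?thesis .
qed

theorem theorem1p1:
  fixes \<epsilon> :: real
  assumes "\<epsilon> > 0"
  shows "\<exists>N. \<forall>m n :: nat. m > 0 \<longrightarrow> n > 0 \<longrightarrow> m + n \<ge> N \<longrightarrow>
    ennreal ((1 / 2 - \<epsilon>) * real (m + n)) \<le> ept (grid m n) \<and>
    ept (grid m n) \<le> ennreal ((4 + \<epsilon>) * real (m + n))"
proof -
  \<comment> \<open>The error term of the upper bound divided by \<open>L\<close>, up to the factor
    3.\<close>
  have "(\<lambda>L. real L * (16 / 27) ^ L) \<longlonglongrightarrow> 0"
    using powser_times_n_limit_0[of "16 / 27 :: real"] by simp
  then have "(\<lambda>L. 3 * (real L * (16 / 27) ^ L)) \<longlonglongrightarrow> 3 * 0"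
    by (intro tendsto_mult_left)
  then have "\<forall>\<^sub>F L in sequentially. 3 * (real L * (16 / 27) ^ L) < \<epsilon>"
    using assms by (intro order_tendstoD) auto
  \<comment> \<open>Lets \<open>\<epsilon> * L\<close> absorb the additive loss of 1 in the lower
    bound.\<close>
  moreover have "\<forall>\<^sub>F L in sequentially. 1 / \<epsilon> \<le> real L"
    by (rule eventually_at_top_linorderI[of "nat \<lceil>1 / \<epsilon>\<rceil>"]) linarith
  ultimately have "\<forall>\<^sub>F L in sequentially. 3 * (real L * (16 / 27) ^ L) < \<epsilon> \<and> 1 / \<epsilon> \<le> real L"
    by (rule eventually_conj)
  then obtain N where N: "3 * (real L * (16 / 27) ^ L) < \<epsilon>" "1 / \<epsilon> \<le> real L" if "N \<le> L" for L
    unfolding eventually_sequentially by blast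
  show ?thesis
  proof (intro exI[of _ N] allI impI conjI)
    fix m n :: nat assume mn: "m > 0" "n > 0" "N \<le> m + n"
    have "1 \<le> \<epsilon> * real (m + n)"
      using N(2)[OF mn(3)] assms by (simp add: field_simps)
    then have "real (m + n) / 2 - \<epsilon> * real (m + n) \<le> real (m + n) / 2 - 1"
      by (rule diff_left_mono)
    then have "(1 / 2 - \<epsilon>) * real (m + n) \<le> real (m + n) / 2 - 1"
      by (simp only: left_diff_distrib)
    then show "ennreal ((1 / 2 - \<epsilon>) * real (m + n)) \<le> ept (grid m n)"
      using ept_grid_lower[OF mn(1,2)] by (meson ennreal_leI order_trans)
    have "3 * (real (m + n))\<^sup>2 * (16 / 27) ^ (m + n)
        = real (m + n) * (3 * (real (m + n) * (16 / 27) ^ (m + n)))"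
      by (simp add: power2_eq_square)
    also have "\<dots> \<le> real (m + n) * \<epsilon>"
      by (rule mult_left_mono[OF less_imp_le[OF N(1)[OF mn(3)]]]) simp
    finally have "4 * real (m + n) + 3 * (real (m + n))\<^sup>2 * (16 / 27) ^ (m + n) \<le> (4 + \<epsilon>) * real (m + n)"
      by (simp add: algebra_simps)
    then show "ept (grid m n) \<le> ennreal ((4 + \<epsilon>) * real (m + n))"
      using ept_grid_upper[OF mn(1,2)] by (meson ennreal_leI order_trans)
  qed
qed

end
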